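(* Let $\overline{B}(n,x)=\sum_{b=2}^{\lfloor x\rfloor}\frac{n-1}{b-1}d_b(n)\log b$. Then for all integers $n\ge 2$ and real $\alpha\in\left[\frac1{\sqrt n},1\right]$, $$\overline{B}(n,\alpha n)=f_{\overline{B}}(\alpha)\,n^2\log n+g_{\overline{B}}(\alpha)\,n^2+O\left(n^{3/2}\log n\right),$$ in which: (a) $f_{\overline{B}}$ is the function with $f_{\overline{B}}(0)=0$ and defined for all $\alpha>0$ by $$f_{\overline{B}}(\alpha)=(1-\gamma)+\left(H_{\lfloor\frac1\alpha\rfloor}-\log\frac1\alpha\right)-\alpha\left\lfloor\frac1\alpha\right\rfloor;$$ (b) $g_{\overline{B}}$ is the function with $g_{\overline{B}}(0)=0$ and defined for all $\alpha>0$ by $$g_{\overline{B}}(\alpha)=\left(\gamma+\gamma_1-1\right)-\left(H_{\lfloor\frac1\alpha\rfloor}-\log\frac1\alpha\right)-\left(J_{\lfloor\frac1\alpha\rfloor}-\frac12\left(\log\frac1\alpha\right)^2\right)+\left(\log\frac1\alpha\right)\left(-1+\alpha\left\lfloor\frac1\alpha\right\rfloor\right)+\alpha\left\lfloor\frac1\alpha\right\rfloor.$$ Moreover, for all integers $n\ge 2$ and real $\alpha\in\left[\frac1n,\frac1{\sqrt n}\right]$, $$\overline{B}(n,\alpha n)=O\left(n^{3/2}\log n\right).$$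
   Context: For integers $b\ge 2$ and $n\ge 1$, $d_b(n)$ denotes the sum of the base-$b$ digits of $n$. $H_m=\sum_{j=1}^m\frac1j$ and $J_m=\sum_{j=1}^m\frac{\log j}{j}$. $\gamma$ is Euler's constant and $\gamma_1=\lim_{n\to\infty}\left(\sum_{k=1}^n\frac{\log k}{k}-\frac{(\log n)^2}{2}\right)$ is the first Stieltjes constant. The constants implied by the $O$-notation are absolute (independent of $n$ and $\alpha$). *)

theory Defs
  imports "HOL-Analysis.Analysis"
begin

text \<open>For \<open>b \<ge> 2\<close> the positions \<open>i\<close> with \<open>b ^ i \<le> n\<close> are exactly those of the base-\<open>b\<close>
  expansion of \<open>n\<close>, the digit at position \<open>i\<close> being \<open>n div b ^ i mod b\<close>.\<close>

definition digit_sum :: "nat \<Rightarrow> nat \<Rightarrow> nat" where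
  "digit_sum b n = (\<Sum>i | b ^ i \<le> n. n div b ^ i mod b)"

text \<open>The harmonic numbers and Euler's constant are \<^const>\<open>harm\<close> and
  \<^const>\<open>euler_mascheroni\<close>; \<open>J_num\<close> and \<open>stieltjes1\<close> are their logarithmic analogues.\<close>

definition J_num :: "nat \<Rightarrow> real" where
  "J_num m = (\<Sum>j=1..m. ln (real j) / real j)"

definition stieltjes1 :: real where
  "stieltjes1 = lim (\<lambda>n. (\<Sum>k=1..n. ln (real k) / real k) - (ln (real n))\<^sup>2 / 2)"

definition B_bar :: "nat \<Rightarrow> real \<Rightarrow> real" where
  "B_bar n x = (\<Sum>b=2..nat \<lfloor>x\<rfloor>.
     (real n - 1) / (real b - 1) * real (digit_sum b n) * ln (real b))"

text \<open>Both coefficient functions live on \<open>[0, \<infinity>)\<close>; the value \<open>0\<close> at negative arguments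
  is only a totalization.\<close>

definition f_B :: "real \<Rightarrow> real" where
  "f_B \<alpha> = (if \<alpha> > 0 then
     (1 - euler_mascheroni) + (harm (nat \<lfloor>1 / \<alpha>\<rfloor>) - ln (1 / \<alpha>))
       - \<alpha> * real_of_int \<lfloor>1 / \<alpha>\<rfloor>
   else 0)"

definition g_B :: "real \<Rightarrow> real" where
  "g_B \<alpha> = (if \<alpha> > 0 then
     (euler_mascheroni + stieltjes1 - 1)
       - (harm (nat \<lfloor>1 / \<alpha>\<rfloor>) - ln (1 / \<alpha>))
       - (J_num (nat \<lfloor>1 / \<alpha>\<rfloor>) - 1 / 2 * (ln (1 / \<alpha>))\<^sup>2)
       + ln (1 / \<alpha>) * (- 1 + \<alpha> * real_of_int \<lfloor>1 / \<alpha>\<rfloor>)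
       + \<alpha> * real_of_int \<lfloor>1 / \<alpha>\<rfloor>
   else 0)"

end

theory Submission
  imports Defs
begin

text \<open>Bases \<open>b \<le> sqrt n\<close> contribute only \<open>O(n\<^bsup>3/2\<^esup> log n)\<close>. A base \<open>b > sqrt n\<close> gives two digits,
  so \<open>d\<^sub>b(n) = n - (b - 1) (n div b)\<close>, and up to the same error the sum is \<open>n\<close> times
  the sum of \<open>(n / b - n div b) log b\<close> over \<open>sqrt n < b \<le> \<alpha> n\<close>. Writing \<open>n div b\<close> as the number of
  \<open>j \<le> sqrt n\<close> with \<open>j b \<le> n\<close> and exchanging the summations leaves at most \<open>sqrt n\<close> sums
  of logarithms, each known up to \<open>O(log n)\<close>; the main terms are then harmonic sums and their
  logarithmic analogues at \<open>\<lfloor>1/\<alpha>\<rfloor>\<close>, \<open>\<lfloor>sqrt n\<rfloor>\<close> and \<open>\<lfloor>\<alpha> n\<rfloor>\<close>.\<close>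

section \<open>Sums compared with antiderivatives\<close>

text \<open>By the mean value theorem \<open>D m\<close>, the sum minus \<open>F m\<close>,
  decreases while \<open>D m - f m\<close> increases, so that
  \<open>D m - f m \<le> c \<le> D m\<close> for the limit \<open>c\<close>. Moving from
  \<open>m = \<lfloor>t\<rfloor>\<close> to \<open>t\<close> subtracts an amount between
  \<open>0\<close> and \<open>f m\<close>. The two deviations have opposite signs, hence the bound
  \<open>f m\<close> instead of \<open>2 * f m\<close>.\<close>

lemma antimono_sum_minus_antiderivative:
  fixes f F :: "real \<Rightarrow> real"
  assumes nonneg: "\<And>t. t \<ge> 1 \<Longrightarrow> f t \<ge> 0"
    and anti: "\<And>s t. 1 \<le> s \<Longrightarrow> s \<le> t \<Longrightarrow> f t \<le> f s"
    and deriv: "\<And>t. t \<ge> 1 \<Longrightarrow> (F has_real_derivative f t) (at t)"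
  obtains c where "(\<lambda>m. (\<Sum>k=1..m. f (real k)) - F (real m)) \<longlonglongrightarrow> c"
    and "\<And>t. t \<ge> 1 \<Longrightarrow> \<bar>(\<Sum>k=1..nat \<lfloor>t\<rfloor>. f (real k)) - F t - c\<bar> \<le> f (real (nat \<lfloor>t\<rfloor>))"
proof -
  define D where "D = (\<lambda>m::nat. (\<Sum>k=1..m. f (real k)) - F (real m))"
  have mvt: "f b * (b - a) \<le> F b - F a \<and> F b - F a \<le> f a * (b - a)"
    if "1 \<le> a" "a \<le> b" for a b
  proof (cases "a = b")
    case False
    then have "a < b" using that by simp
    moreover have "(F has_real_derivative f x) (at x)" if "a \<le> x" for x
      using deriv that \<open>1 \<le> a\<close> by simp
    ultimately obtain z where z: "z > a" "z < b" "F b - F a = (b - a) * f z"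
      using MVT2[of a b F f] by blast
    show ?thesis
      using z anti[of a z] anti[of z b] that
      by (auto simp: mult.commute[of "b - a"] intro!: mult_right_mono)
  qed simp
  have step: "D (Suc m) \<le> D m \<and> D m - f m \<le> D (Suc m) - f (Suc m)" if "m \<ge> 1" for m
    using mvt[of "real m" "real (Suc m)"] that by (simp add: D_def)
  have mono: "D p \<le> D m \<and> D m - f m \<le> D p - f p" if "1 \<le> m" "m \<le> p" for m p
    using that(2)
  proof (induction p rule: dec_induct)
    case (step p)
    then show ?case using \<open>1 \<le> m\<close> \<open>\<And>m. 1 \<le> m \<Longrightarrow> D (Suc m) \<le> D m \<and> D m - f m \<le> D (Suc m) - f (Suc m)\<close>[of p]
      by force
  qed simp
  have low: "D m - f m \<le> D p" if "1 \<le> m" "m \<le> p" for m p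
    using mono[OF that] nonneg[of "real p"] that by simp
  \<comment> \<open>The shift by one is there because monotonicity of \<open>D\<close> is known only
    from \<open>m = 1\<close> on.\<close>
  have "decseq (\<lambda>m. D (Suc m))"
    using mono by (auto simp: decseq_def)
  moreover have "\<And>m. D 1 - f 1 \<le> D (Suc m)"
    using low[of 1] by simp
  ultimately obtain c where "(\<lambda>m. D (Suc m)) \<longlonglongrightarrow> c"
    using decseq_convergent by blast
  then have lim: "D \<longlonglongrightarrow> c"
    by (rule LIMSEQ_imp_Suc)
  show ?thesis
  proof
    show "(\<lambda>m. (\<Sum>k=1..m. f (real k)) - F (real m)) \<longlonglongrightarrow> c"
      using lim by (simp add: D_def)
    fix t :: real assume t: "t \<ge> 1"
    define m where "m = nat \<lfloor>t\<rfloor>"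
    have m: "1 \<le> m" "real m \<le> t" "t \<le> real m + 1"
      using t by (auto simp: m_def le_nat_floor)
    have "c \<le> D m"
      using lim mono m(1) by (intro LIMSEQ_le_const2[of D]) auto
    moreover have "D m - f m \<le> c"
      using lim low m(1) by (intro LIMSEQ_le_const[of D]) auto
    moreover have "0 \<le> f t * (t - m)"
      using nonneg t m by simp
    moreover have "f m * (t - m) \<le> f m * 1"
      using nonneg[of "real m"] m by (intro mult_left_mono) auto
    ultimately show "\<bar>(\<Sum>k=1..nat \<lfloor>t\<rfloor>. f (real k)) - F t - c\<bar> \<le> f (real (nat \<lfloor>t\<rfloor>))"
      using conjunct1[OF mvt[of "real m" t]] conjunct2[OF mvt[of "real m" t]] m
      unfolding m_def[symmetric] D_def by linarith
  qed
qed

lemma nat_floor_bounds: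
  fixes t :: real
  assumes "t \<ge> 1"
  shows "t / 2 \<le> real (nat \<lfloor>t\<rfloor>)" "1 \<le> nat \<lfloor>t\<rfloor>" "real (nat \<lfloor>t\<rfloor>) \<le> t"
    "t < real (nat \<lfloor>t\<rfloor>) + 1"
proof -
  show *: "1 \<le> nat \<lfloor>t\<rfloor>" and "real (nat \<lfloor>t\<rfloor>) \<le> t" using assms by (auto simp: le_nat_floor)
  show "t < real (nat \<lfloor>t\<rfloor>) + 1" using assms by linarith
  moreover have "1 \<le> real (nat \<lfloor>t\<rfloor>)" using * by linarith
  ultimately show "t / 2 \<le> real (nat \<lfloor>t\<rfloor>)" by linarith
qed

text \<open>The limit is exported together with the bound so that \<open>c\<close> can be identified
  later: as Euler's constant, and as the part to subtract in the limit defining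
  \<open>stieltjes1\<close>.\<close>

lemma inverse_sum_asymp:
  obtains c where "(\<lambda>m. (\<Sum>k=1..m. 1 / real k) - ln (real m)) \<longlonglongrightarrow> c"
    and "\<And>t. t \<ge> 1 \<Longrightarrow> \<bar>(\<Sum>k=1..nat \<lfloor>t\<rfloor>. 1 / real k) - ln t - c\<bar> \<le> 2 / t"
proof -
  obtain c where c: "(\<lambda>m. (\<Sum>k=1..m. 1 / real k) - ln (real m)) \<longlonglongrightarrow> c"
    "\<And>t. t \<ge> 1 \<Longrightarrow> \<bar>(\<Sum>k=1..nat \<lfloor>t\<rfloor>. 1 / real k) - ln t - c\<bar> \<le> 1 / real (nat \<lfloor>t\<rfloor>)"
    by (rule antimono_sum_minus_antiderivative[of "\<lambda>t. 1 / t" ln])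
       (auto intro!: derivative_eq_intros divide_left_mono simp: frac_le)
  show ?thesis
  proof (rule that[OF c(1)])
    fix t :: real assume t: "t \<ge> 1"
    have "1 / real (nat \<lfloor>t\<rfloor>) \<le> 1 / (t / 2)"
      using nat_floor_bounds[OF t] t by (intro divide_left_mono) auto
    then show "\<bar>(\<Sum>k=1..nat \<lfloor>t\<rfloor>. 1 / real k) - ln t - c\<bar> \<le> 2 / t"
      using c(2)[OF t] by simp
  qed
qed

lemma harm_asymp:
  fixes t :: real
  assumes "t \<ge> 1"
  shows "\<bar>harm (nat \<lfloor>t\<rfloor>) - ln t - euler_mascheroni\<bar> \<le> 2 / t"
proof -
  obtain c where c: "(\<lambda>m. (\<Sum>k=1..m. 1 / real k) - ln (real m)) \<longlonglongrightarrow> c"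
    "\<And>t. t \<ge> 1 \<Longrightarrow> \<bar>(\<Sum>k=1..nat \<lfloor>t\<rfloor>. 1 / real k) - ln t - c\<bar> \<le> 2 / t"
    using inverse_sum_asymp by blast
  have h: "harm m = (\<Sum>k=1..m. 1 / real k)" for m
    by (simp add: harm_def inverse_eq_divide)
  have "c = euler_mascheroni"
    using c(1) euler_mascheroni_LIMSEQ LIMSEQ_unique by (auto simp: h)
  then show ?thesis using c(2)[OF assms] by (simp add: h)
qed

text \<open>\<open>ln t / t\<close> is monotone only from \<open>exp 1\<close> on, but it is the difference of the
  antitone functions \<open>(1 + ln t) / t\<close> and \<open>1 / t\<close>.\<close>

lemma J_num_asymp:
  assumes "t \<ge> 1"
  shows "\<bar>J_num (nat \<lfloor>t\<rfloor>) - (ln t)\<^sup>2 / 2 - stieltjes1\<bar> \<le> (4 + 2 * ln t) / t"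
proof -
  obtain c where c: "(\<lambda>m. (\<Sum>k=1..m. 1 / real k) - ln (real m)) \<longlonglongrightarrow> c"
    "\<And>t. t \<ge> 1 \<Longrightarrow> \<bar>(\<Sum>k=1..nat \<lfloor>t\<rfloor>. 1 / real k) - ln t - c\<bar> \<le> 2 / t"
    using inverse_sum_asymp by blast
  have anti: "(1 + ln b) / b \<le> (1 + ln a) / a" if "1 \<le> a" "a \<le> b" for a b :: real
  proof (rule DERIV_nonpos_imp_nonincreasing[OF that(2)])
    fix x assume x: "a \<le> x" "x \<le> b"
    then have "((\<lambda>x. (1 + ln x) / x) has_real_derivative - ln x / (x * x)) (at x)"
      using that by (auto intro!: derivative_eq_intros simp: field_simps)
    moreover have "- ln x / (x * x) \<le> 0"
      using x that by (simp add: divide_nonpos_nonneg)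
    ultimately show "\<exists>y. ((\<lambda>x. (1 + ln x) / x) has_real_derivative y) (at x) \<and> y \<le> 0"
      by blast
  qed
  obtain d where d: "(\<lambda>m. (\<Sum>k=1..m. (1 + ln (real k)) / real k) - (ln (real m) + (ln (real m))\<^sup>2 / 2)) \<longlonglongrightarrow> d"
    "\<And>t. t \<ge> 1 \<Longrightarrow> \<bar>(\<Sum>k=1..nat \<lfloor>t\<rfloor>. (1 + ln (real k)) / real k) - (ln t + (ln t)\<^sup>2 / 2) - d\<bar>
       \<le> (1 + ln (real (nat \<lfloor>t\<rfloor>))) / real (nat \<lfloor>t\<rfloor>)"
    by (rule antimono_sum_minus_antiderivative[of "\<lambda>t. (1 + ln t) / t" "\<lambda>t. ln t + (ln t)\<^sup>2 / 2"])
       (use anti in \<open>auto intro!: derivative_eq_intros simp: field_simps\<close>)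
  have J: "J_num m = (\<Sum>k=1..m. (1 + ln (real k)) / real k) - (\<Sum>k=1..m. 1 / real k)" for m
    by (simp add: J_num_def sum_subtractf[symmetric] add_divide_distrib)
  \<comment> \<open>\<open>stieltjes1\<close> is defined by \<open>lim\<close>, so its value becomes
    available only through convergence, which the two sums supply by subtraction.\<close>
  have "(\<lambda>n. J_num n - (ln (real n))\<^sup>2 / 2) \<longlonglongrightarrow> d - c"
    using tendsto_diff[OF d(1) c(1)] by (simp add: J algebra_simps)
  then have st: "stieltjes1 = d - c"
    unfolding stieltjes1_def J_num_def[symmetric] by (rule limI)
  define m where "m = real (nat \<lfloor>t\<rfloor>)"
  have m: "t / 2 \<le> m" "1 \<le> m" "m \<le> t"
    using nat_floor_bounds[OF assms] by (auto simp: m_def)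
  have "(1 + ln m) / m \<le> (1 + ln t) / (t / 2)"
    using m assms by (intro frac_le) auto
  also have "\<dots> = (2 + 2 * ln t) / t" by simp
  finally have "\<bar>(\<Sum>k=1..nat \<lfloor>t\<rfloor>. (1 + ln (real k)) / real k) - (ln t + (ln t)\<^sup>2 / 2) - d\<bar> \<le> (2 + 2 * ln t) / t"
    using d(2)[OF assms] by (simp add: m_def)
  moreover have "(4 + 2 * ln t) / t = (2 + 2 * ln t) / t + 2 / t"
    by (simp add: add_divide_distrib)
  ultimately show ?thesis
    using c(2)[OF assms] unfolding J st by linarith
qed

text \<open>With \<open>F t = t * ln t - t\<close>, the sum minus \<open>F\<close> equals
  \<open>1\<close> at \<open>m = 1\<close>, and each step raises it by at most
  \<open>ln (m + 1) - ln m\<close>, so it stays between \<open>1\<close> and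
  \<open>1 + ln m\<close>. From \<open>m = \<lfloor>t\<rfloor>\<close> to \<open>t\<close> the
  function \<open>F\<close> grows by at most \<open>ln t\<close>.\<close>

lemma ln_sum_asymp:
  assumes "t \<ge> 1"
  shows "\<bar>(\<Sum>k=1..nat \<lfloor>t\<rfloor>. ln (real k)) - (t * ln t - t)\<bar> \<le> 1 + ln t"
proof -
  define F where "F = (\<lambda>t::real. t * ln t - t)"
  have mvt: "ln a * (b - a) \<le> F b - F a \<and> F b - F a \<le> ln b * (b - a)"
    if "1 \<le> a" "a \<le> b" for a b :: real
  proof (cases "a = b")
    case False
    then have "a < b" using that by simp
    moreover have "(F has_real_derivative ln x) (at x)" if "a \<le> x" for x
      using that \<open>1 \<le> a\<close> unfolding F_def by (auto intro!: derivative_eq_intros)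
    ultimately obtain z where z: "z > a" "z < b" "F b - F a = (b - a) * ln z"
      using MVT2[of a b F ln] by blast
    show ?thesis
      using z that by (auto simp: mult.commute[of "b - a"] intro!: mult_right_mono)
  qed simp
  have m: "1 \<le> (\<Sum>k=1..m. ln (real k)) - F m \<and> (\<Sum>k=1..m. ln (real k)) - F m \<le> 1 + ln m"
    if "1 \<le> m" for m
    using that
  proof (induction m rule: dec_induct)
    case base
    show ?case by (simp add: F_def)
  next
    case (step m)
    have "ln (real m) \<le> F (real (Suc m)) - F m \<and> F (real (Suc m)) - F m \<le> ln (real (Suc m))"
      using mvt[of "real m" "real (Suc m)"] step(1) by simp
    then show ?case using step by simp
  qed
  define m where "m = nat \<lfloor>t\<rfloor>"
  have mt: "1 \<le> m" "real m \<le> t" "t \<le> real m + 1"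
    using assms by (auto simp: m_def le_nat_floor)
  have "F t - F m \<le> ln t * (t - m)" "ln m * (t - m) \<le> F t - F m"
    using mvt[of "real m" t] mt by auto
  moreover have "ln t * (t - m) \<le> ln t * 1"
    using mt assms by (intro mult_left_mono) auto
  moreover have "0 \<le> ln m * (t - m)" using mt by simp
  moreover have "ln m \<le> ln t" using mt by simp
  ultimately show ?thesis
    using m[OF mt(1)] unfolding m_def[symmetric] F_def by linarith
qed

section \<open>Digit sums and the bases up to sqrt n\<close>

text \<open>There are at most \<open>q + 1\<close> digits, where \<open>q\<close> is the logarithm
  of \<open>n\<close> to base \<open>b\<close>, and each is at most \<open>b - 1\<close>. The factor
  \<open>ln b\<close> turns \<open>q\<close> into \<open>ln n\<close>.\<close>

lemma digit_sum_le:
  assumes "b \<ge> 2" "n \<ge> 1"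
  shows "real (digit_sum b n) * ln b \<le> (real b - 1) * (ln b + ln n)"
proof -
  define q where "q = ln n / ln b"
  have lnb: "ln b > 0" using assms by simp
  have q: "q \<ge> 0" using assms lnb by (simp add: q_def)
  have sub: "{i. b ^ i \<le> n} \<subseteq> {..nat \<lfloor>q\<rfloor>}"
  proof
    fix i assume "i \<in> {i. b ^ i \<le> n}"
    then have "real b ^ i \<le> n" by (metis mem_Collect_eq of_nat_le_iff of_nat_power)
    then have "ln (real b ^ i) \<le> ln n"
      using assms by (subst ln_le_cancel_iff) auto
    then have "real i * ln b \<le> ln n" using assms by (simp add: ln_realpow)
    then have "real i \<le> q" using lnb by (simp add: q_def field_simps)
    then show "i \<in> {..nat \<lfloor>q\<rfloor>}" by (simp add: le_nat_floor)
  qed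
  have "digit_sum b n \<le> (\<Sum>i | b ^ i \<le> n. b - 1)"
    unfolding digit_sum_def using assms
    by (intro sum_mono) (metis Suc_pred' less_Suc_eq_le mod_less_divisor not_numeral_le_zero zero_less_iff_neq_zero)
  also have "\<dots> \<le> (nat \<lfloor>q\<rfloor> + 1) * (b - 1)"
    using card_mono[OF _ sub] by (simp only: sum_constant of_nat_id) (intro mult_right_mono, auto)
  finally have "real (digit_sum b n) \<le> real ((nat \<lfloor>q\<rfloor> + 1) * (b - 1))"
    by linarith
  also have "\<dots> = (real (nat \<lfloor>q\<rfloor>) + 1) * (real b - 1)"
    using assms by (simp only: of_nat_mult of_nat_add of_nat_1) (simp add: of_nat_diff)
  also have "\<dots> \<le> (q + 1) * (real b - 1)"
    using assms q by (intro mult_right_mono) auto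
  finally have "real (digit_sum b n) * ln b \<le> (q + 1) * (real b - 1) * ln b"
    using lnb by (intro mult_right_mono) auto
  also have "\<dots> = (real b - 1) * (ln b + ln n)"
    using lnb by (simp add: q_def field_simps)
  finally show ?thesis .
qed

text \<open>Only positions \<open>0\<close> and \<open>1\<close> occur, with digits
  \<open>n mod b\<close> and \<open>n div b\<close>; then \<open>n mod b\<close> is eliminated by
  division with remainder.\<close>

lemma digit_sum_two_digits:
  assumes "n < b\<^sup>2" "b \<ge> 2" "b \<le> n"
  shows "real (digit_sum b n) = real n - (real b - 1) * real (n div b)"
proof -
  have "{i. b ^ i \<le> n} = {0, 1}"
  proof (intro equalityI subsetI)
    fix i assume "i \<in> {i. b ^ i \<le> n}"
    then have "b ^ i < b ^ 2" using assms(1) by simp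
    then have "i < 2" using assms(2) by (intro power_less_imp_less_exp[of b i 2]) simp
    then show "i \<in> {0, 1}" by auto
  qed (use assms in auto)
  then have "digit_sum b n = n mod b + n div b"
    using assms by (simp add: digit_sum_def less_mult_imp_div_less power2_eq_square)
  moreover have "real n = real b * real (n div b) + real (n mod b)"
    by (metis mult_div_mod_eq of_nat_add of_nat_mult)
  ultimately show ?thesis by (simp add: algebra_simps)
qed

text \<open>The factor \<open>b - 1\<close> in the digit bound cancels the denominator, which makes
  the estimate uniform in \<open>b\<close>.\<close>

lemma B_bar_term_bounds:
  fixes b n :: nat
  assumes "b \<ge> 2" "b \<le> n"
  shows "0 \<le> (real n - 1) / (real b - 1) * real (digit_sum b n) * ln b"
    and "(real n - 1) / (real b - 1) * real (digit_sum b n) * ln b \<le> 2 * real n * ln n"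
proof -
  show "0 \<le> (real n - 1) / (real b - 1) * real (digit_sum b n) * ln b"
    using assms by simp
  have "(real n - 1) / (real b - 1) * real (digit_sum b n) * ln b
     \<le> (real n - 1) / (real b - 1) * ((real b - 1) * (ln b + ln n))"
    unfolding mult.assoc using assms digit_sum_le[of b n] by (intro mult_left_mono) auto
  also have "\<dots> = (real n - 1) * (ln b + ln n)"
    using assms by simp
  also have "\<dots> \<le> n * (ln n + ln n)"
    using assms by (intro mult_mono add_mono) auto
  finally show "(real n - 1) / (real b - 1) * real (digit_sum b n) * ln b \<le> 2 * real n * ln n"
    by simp
qed

text \<open>At most \<open>sqrt n\<close> terms, each at most \<open>2 * n * ln n\<close>. This
  serves both for the small bases when \<open>\<alpha> \<ge> 1 / sqrt n\<close> and for the whole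
  sum when \<open>\<alpha> \<le> 1 / sqrt n\<close>.\<close>

lemma B_bar_initial_bound:
  assumes "n \<ge> 2" "real m \<le> sqrt n"
  shows "\<bar>\<Sum>b=2..m. (real n - 1) / (real b - 1) * real (digit_sum b n) * ln b\<bar>
     \<le> 2 * (n * sqrt n * ln n)"
proof -
  have sn: "sqrt n \<le> n" using assms by (simp add: real_le_lsqrt power2_eq_square)
  have bn: "b \<le> n" if "b \<in> {2..m}" for b
    using that sn assms by auto
  have "\<bar>\<Sum>b=2..m. (real n - 1) / (real b - 1) * real (digit_sum b n) * ln b\<bar>
     \<le> (\<Sum>b=2..m. 2 * real n * ln n)"
    by (intro order_trans[OF sum_abs] sum_mono, subst abs_of_nonneg)
       (use B_bar_term_bounds[OF _ bn] in auto)
  also have "\<dots> \<le> sqrt n * (2 * real n * ln n)"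
    using assms by (simp only: sum_constant card_atLeastAtMost) (intro mult_right_mono, auto)
  finally show ?thesis by (simp add: algebra_simps)
qed

section \<open>Bases above sqrt n: reduction to fractional parts\<close>

text \<open>Each term is \<open>1 / (b - 1) - 1 / b\<close>, so the sum telescopes.\<close>

lemma sum_inverse_consecutive_le:
  assumes "1 \<le> M" "M \<le> X"
  shows "(\<Sum>b\<in>{M<..X}. 1 / (real b * (real b - 1))) \<le> 1 / real M"
proof -
  have "(\<Sum>b\<in>{M<..X}. 1 / (real b * (real b - 1))) = 1 / real M - 1 / real X"
    using assms(2)
  proof (induction X rule: dec_induct)
    case (step X)
    have "{M<..Suc X} = insert (Suc X) {M<..X}" using step by auto
    moreover have "1 / (real (Suc X) * (real (Suc X) - 1)) = 1 / real X - 1 / real (Suc X)"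
      using step assms(1) by (simp add: field_simps)
    ultimately show ?case using step by simp
  qed simp
  then show ?thesis by simp
qed


text \<open>Every \<open>b > M\<close> has \<open>n < b\<^sup>2\<close>, so the two-digit formula
  applies. Apart from the weight \<open>ln b \<le> ln n\<close>, the replacement errors telescope to
  at most \<open>n\<^sup>2 / M\<close>, plus at most \<open>1\<close> per base from the fractional
  parts.\<close>

lemma B_bar_tail:
  fixes n M X :: nat
  assumes "1 \<le> M" "M \<le> X" "X \<le> n" "n < (M + 1)\<^sup>2"
  shows "\<bar>(\<Sum>b\<in>{M<..X}. (real n - 1) / (real b - 1) * real (digit_sum b n) * ln b)
     - real n * (\<Sum>b\<in>{M<..X}. (real n / b - real (n div b)) * ln b)\<bar>
     \<le> ((real n)\<^sup>2 / M + n) * ln n"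
proof -
  have "\<bar>(\<Sum>b\<in>{M<..X}. (real n - 1) / (real b - 1) * real (digit_sum b n) * ln b)
     - real n * (\<Sum>b\<in>{M<..X}. (real n / b - real (n div b)) * ln b)\<bar>
     \<le> (\<Sum>b\<in>{M<..X}. \<bar>(real n - 1) / (real b - 1) * real (digit_sum b n) * ln b
           - real n * ((real n / b - real (n div b)) * ln b)\<bar>)"
    unfolding sum_distrib_left sum_subtractf[symmetric] by (rule sum_abs)
  also have "\<dots> \<le> (\<Sum>b\<in>{M<..X}. ((real n)\<^sup>2 * (1 / (real b * (real b - 1))) + 1) * ln n)"
  proof (rule sum_mono)
    fix b assume b: "b \<in> {M<..X}"
    define q where "q = real (n div b)"
    have b2: "2 \<le> b" "b \<le> n" using b assms by auto
    have "(M + 1)\<^sup>2 \<le> b\<^sup>2" using b by (intro power_mono) auto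
    then have d: "real (digit_sum b n) = real n - (real b - 1) * q"
      unfolding q_def using digit_sum_two_digits[of n b] assms b2 by linarith
    have q: "q = of_int \<lfloor>real n / b\<rfloor>" by (simp add: q_def floor_divide_of_nat_eq)
    have r: "0 \<le> real n / b - q" "real n / b - q \<le> 1" unfolding q by linarith+
    \<comment> \<open>The exact error of one term, a difference of two nonnegative quantities: the
      first is telescopable, the second is the fractional part of \<open>n / b\<close>.\<close>
    have "(real n - 1) / (real b - 1) * real (digit_sum b n) - real n * (real n / b - q)
        = (real n - 1) * real n * (1 / (real b * (real b - 1))) - (real n / b - q)"
      unfolding d using b2 by (simp add: divide_simps) (simp add: algebra_simps)
    moreover have "(real n - 1) * real n * (1 / (real b * (real b - 1)))
        \<le> (real n)\<^sup>2 * (1 / (real b * (real b - 1)))"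
      unfolding power2_eq_square using b2 by (intro mult_right_mono) auto
    moreover have "0 \<le> (real n - 1) * real n * (1 / (real b * (real b - 1)))"
      using b2 by simp
    ultimately have "\<bar>(real n - 1) / (real b - 1) * real (digit_sum b n) - real n * (real n / b - q)\<bar>
        \<le> (real n)\<^sup>2 * (1 / (real b * (real b - 1))) + 1"
      using r by linarith
    then have "\<bar>(real n - 1) / (real b - 1) * real (digit_sum b n) - real n * (real n / b - q)\<bar> * ln b
        \<le> ((real n)\<^sup>2 * (1 / (real b * (real b - 1))) + 1) * ln n"
      using b2 by (intro mult_mono) auto
    moreover have "\<bar>u * ln b - real n * (v * ln b)\<bar> = \<bar>u - real n * v\<bar> * ln b" for u v
    proof -
      have "u * ln b - real n * (v * ln b) = (u - real n * v) * ln b"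
        by (simp add: algebra_simps)
      then show ?thesis using b2 by (simp add: abs_mult)
    qed
    ultimately show "\<bar>(real n - 1) / (real b - 1) * real (digit_sum b n) * ln b
           - real n * ((real n / b - real (n div b)) * ln b)\<bar>
        \<le> ((real n)\<^sup>2 * (1 / (real b * (real b - 1))) + 1) * ln n"
      unfolding q_def by (simp only:)
  qed
  also have "\<dots> = ((real n)\<^sup>2 * (\<Sum>b\<in>{M<..X}. 1 / (real b * (real b - 1))) + real (X - M)) * ln n"
    by (simp add: sum_distrib_right[symmetric] sum.distrib sum_distrib_left)
  also have "\<dots> \<le> ((real n)\<^sup>2 * (1 / M) + n) * ln n"
    using assms sum_inverse_consecutive_le[of M X]
    by (intro mult_right_mono add_mono mult_left_mono) auto
  finally show ?thesis by simp
qed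

section \<open>Exchanging summations under the hyperbola j b \<le> n\<close>

text \<open>The first two hypotheses say that \<open>M\<close> is the integer square root of
  \<open>n\<close>. The pair \<open>(K, X)\<close> separates two regimes after the exchange: for
  \<open>j \<le> K\<close> the condition \<open>j * b \<le> n\<close> holds for all
  \<open>b \<le> X\<close>, while for \<open>j > K\<close> it cuts the range at
  \<open>n div j \<le> X\<close>. Each of the \<open>M\<close> values of \<open>j\<close>
  contributes one \<open>- L M\<close>.\<close>

lemma sum_div_hyperbola:
  fixes g :: "nat \<Rightarrow> real" and n M X K :: nat
  assumes "M * M \<le> n" "n < (M + 1) * (M + 1)" "M \<le> X"
    and "K \<le> M" "K * X \<le> n" "n < (K + 1) * (X + 1)"
  defines "L \<equiv> \<lambda>m. \<Sum>k=1..m. g k"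
  shows "(\<Sum>b\<in>{M<..X}. real (n div b) * g b)
     = real K * L X + (\<Sum>j\<in>{K<..M}. L (n div j)) - real M * L M"
proof -
  have diff: "(\<Sum>b\<in>{M<..m}. g b) = L m - L M" if "M \<le> m" for m
  proof -
    have "{1..m} = {1..M} \<union> {M<..m}" using that by auto
    then have "L m = L M + (\<Sum>b\<in>{M<..m}. g b)"
      unfolding L_def by (simp add: sum.union_disjoint ivl_disj_int)
    then show ?thesis by simp
  qed
  have "(\<Sum>b\<in>{M<..X}. real (n div b) * g b) = (\<Sum>b\<in>{M<..X}. \<Sum>j=1..M. if j * b \<le> n then g b else 0)"
  proof (rule sum.cong[OF refl])
    fix b assume b: "b \<in> {M<..X}"
    \<comment> \<open>Since \<open>b > M\<close>, the quotient \<open>n div b\<close> is at most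
      \<open>M\<close>; hence one range for \<open>j\<close> works for every \<open>b\<close> and
      the sums can be swapped.\<close>
    have "(M + 1) * (M + 1) \<le> (M + 1) * b" using b by (intro mult_le_mono) auto
    then have "n div b < M + 1"
      using assms(2) by (intro less_mult_imp_div_less) linarith
    moreover have "j * b \<le> n \<longleftrightarrow> j \<le> n div b" for j
      using b by (simp add: less_eq_div_iff_mult_less_eq)
    ultimately have "{j \<in> {1..M}. j * b \<le> n} = {1..n div b}"
      by (intro set_eqI) force
    then show "real (n div b) * g b = (\<Sum>j=1..M. if j * b \<le> n then g b else 0)"
      by (simp flip: sum.inter_filter)
  qed
  also have "\<dots> = (\<Sum>j=1..M. \<Sum>b\<in>{M<..X}. if j * b \<le> n then g b else 0)"
    by (rule sum.swap)
  also have "{1..M} = {1..K} \<union> {K<..M}" using assms(4) by auto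
  also have "(\<Sum>j\<in>\<dots>. \<Sum>b\<in>{M<..X}. if j * b \<le> n then g b else 0)
     = (\<Sum>j=1..K. \<Sum>b\<in>{M<..X}. if j * b \<le> n then g b else 0)
       + (\<Sum>j\<in>{K<..M}. \<Sum>b\<in>{M<..X}. if j * b \<le> n then g b else 0)"
    by (intro sum.union_disjoint) auto
  also have "(\<Sum>j=1..K. \<Sum>b\<in>{M<..X}. if j * b \<le> n then g b else 0) = (\<Sum>j=1..K. L X - L M)"
  proof (rule sum.cong[OF refl])
    fix j assume j: "j \<in> {1..K}"
    have "j * b \<le> n" if "b \<in> {M<..X}" for b
      using mult_le_mono[of j K b X] j that assms(5) by simp
    then show "(\<Sum>b\<in>{M<..X}. if j * b \<le> n then g b else 0) = L X - L M"
      using diff[OF assms(3)] by simp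
  qed
  also have "(\<Sum>j\<in>{K<..M}. \<Sum>b\<in>{M<..X}. if j * b \<le> n then g b else 0)
      = (\<Sum>j\<in>{K<..M}. L (n div j) - L M)"
  proof (rule sum.cong[OF refl])
    fix j assume j: "j \<in> {K<..M}"
    \<comment> \<open>From \<open>j > K\<close> follows \<open>n div j \<le> X\<close>, and from
      \<open>j \<le> M\<close> follows \<open>M \<le> n div j\<close>, so the surviving bases are
      exactly \<open>{M<..n div j}\<close>.\<close>
    have "(K + 1) * (X + 1) \<le> (X + 1) * j"
      using j by (subst mult.commute) (intro mult_le_mono, auto)
    then have X: "n div j < X + 1"
      using assms(6) by (intro less_mult_imp_div_less) linarith
    have "M * j \<le> n" using j assms(1) by (intro order_trans[OF mult_le_mono2[of j M]]) auto
    then have M: "M \<le> n div j"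
      using j by (simp add: less_eq_div_iff_mult_less_eq)
    have "j * b \<le> n \<longleftrightarrow> b \<le> n div j" for b
      using j by (simp add: less_eq_div_iff_mult_less_eq mult.commute)
    then have "{b \<in> {M<..X}. j * b \<le> n} = {M<..n div j}"
      using X by (intro set_eqI) force
    then show "(\<Sum>b\<in>{M<..X}. if j * b \<le> n then g b else 0) = L (n div j) - L M"
      using diff[OF M] by (simp flip: sum.inter_filter)
  qed
  finally show ?thesis
    using assms(4) by (simp add: sum_subtractf of_nat_diff algebra_simps)
qed

section \<open>Asymptotics of the fractional-part sum\<close>

text \<open>After all asymptotics are inserted, the terms in \<open>l\<^sup>2\<close> from
  \<open>J_num X\<close> and from \<open>(l - 1) * harm M\<close> cancel. The summand
  \<open>1\<close> of \<open>f_B\<close> is the sum of two halves, one from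
  \<open>(l - 1) * harm M\<close> and one from \<open>M * L M\<close>; the latter also yields the
  \<open>- 1\<close> of \<open>g_B\<close>. The terms with \<open>\<alpha> * K\<close> come from
  \<open>K * L X\<close>.\<close>

lemma fractional_part_sum_asymp:
  fixes n :: nat and \<alpha> :: real
  assumes n: "n \<ge> 2" and \<alpha>: "1 / sqrt n \<le> \<alpha>" "\<alpha> \<le> 1"
  shows "\<bar>(\<Sum>b\<in>{nat \<lfloor>sqrt n\<rfloor><..nat \<lfloor>\<alpha> * n\<rfloor>}. (real n / b - real (n div b)) * ln b)
     - real n * (f_B \<alpha> * ln n + g_B \<alpha>)\<bar> \<le> 28 * (sqrt n * ln n)"
proof -
  define N s l x lam where defs: "N = real n" "s = sqrt n" "l = ln n" "x = \<alpha> * n" "lam = ln (1 / \<alpha>)"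
  define M X K where nats: "M = nat \<lfloor>s\<rfloor>" "X = nat \<lfloor>x\<rfloor>" "K = nat \<lfloor>1 / \<alpha>\<rfloor>"
  define L where "L = (\<lambda>m. \<Sum>k=1..m. ln (real k))"
  have N: "N \<ge> 2" "N = s * s" using n by (auto simp: defs)
  have s: "s \<ge> 1" using n by (simp add: defs)
  have \<alpha>0: "\<alpha> > 0" using \<alpha> n by (smt (verit) of_nat_0_less_iff real_sqrt_gt_zero zero_less_divide_1_iff zero_less_numeral order_less_le_trans)
  \<comment> \<open>This is what lets additive constants be absorbed into multiples of
    \<open>ln n\<close>, down to \<open>n = 2\<close>.\<close>
  have l: "1 \<le> 2 * l"
  proof -
    have "ln 2 \<le> l" using n by (simp add: defs)
    then show ?thesis using ln2_ge_two_thirds by linarith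
  qed
  \<comment> \<open>The lower bound on \<open>\<alpha>\<close> is exactly what places the cutoff
    \<open>x\<close> at or beyond \<open>sqrt n\<close>.\<close>
  have x: "s \<le> x" "x \<le> N"
  proof -
    have "s = 1 / s * N" using N s by simp
    also have "\<dots> \<le> \<alpha> * N" using \<alpha> N by (intro mult_right_mono) (auto simp: defs)
    finally show "s \<le> x" by (simp add: defs)
    show "x \<le> N" using \<alpha> N by (simp add: defs mult_left_le_one_le)
  qed
  have lns: "ln s = l / 2" using n by (simp add: defs ln_sqrt)
  have lnx: "ln x = l - lam" using \<alpha>0 n by (simp add: defs ln_mult ln_div)
  have lnx_le: "0 \<le> ln x" "ln x \<le> l"
  proof -
    show "0 \<le> ln x" using x s by simp
    have "ln x \<le> ln N" using x s by (subst ln_le_cancel_iff) auto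
    then show "ln x \<le> l" by (simp add: defs)
  qed
  have inv\<alpha>: "1 \<le> 1 / \<alpha>" "1 / \<alpha> \<le> s" "1 / \<alpha> * x = N"
    using \<alpha> \<alpha>0 s by (auto simp: defs field_simps)
  have M: "1 \<le> M" "real M \<le> s" "s < real M + 1"
    using nat_floor_bounds[of s] s unfolding nats by auto
  have X: "1 \<le> X" "real X \<le> x" "x < real X + 1"
    using nat_floor_bounds[of x] s x unfolding nats by auto
  have K: "1 \<le> K" "real K \<le> 1 / \<alpha>" "1 / \<alpha> < real K + 1"
    using nat_floor_bounds[OF inv\<alpha>(1)] inv\<alpha> unfolding nats by auto
  have MX: "M \<le> X" unfolding nats using x by (intro nat_mono floor_mono)
  have KM: "K \<le> M" unfolding nats using inv\<alpha> by (intro nat_mono floor_mono)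
  have T: "(\<Sum>b\<in>{M<..X}. real (n div b) * ln b)
     = real K * L X + (\<Sum>j\<in>{K<..M}. L (n div j)) - real M * L M"
    unfolding L_def
  proof (rule sum_div_hyperbola)
    have "real M * real M \<le> s * s" using M by (intro mult_mono) auto
    then show "M * M \<le> n" using N by (simp add: defs flip: of_nat_mult)
    have "s * s < (real M + 1) * (real M + 1)" using M s by (intro mult_strict_mono) auto
    then have "real n < real ((M + 1) * (M + 1))" using N by (simp add: defs algebra_simps)
    then show "n < (M + 1) * (M + 1)" by (simp only: of_nat_less_iff)
    \<comment> \<open>\<open>K\<close> and \<open>X\<close> are the floors of two numbers whose
      product is \<open>N\<close>, which gives both inequalities on \<open>K\<close> and
      \<open>X\<close>.\<close>
    have "real K * real X \<le> 1 / \<alpha> * x" using K X \<alpha>0 by (intro mult_mono) auto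
    then show "K * X \<le> n" using inv\<alpha> by (simp add: defs flip: of_nat_mult)
    have "1 / \<alpha> * x < (real K + 1) * (real X + 1)" using K X s x \<alpha>0 by (intro mult_strict_mono) auto
    then have "real n < real ((K + 1) * (X + 1))" using inv\<alpha> by (simp add: defs algebra_simps)
    then show "n < (K + 1) * (X + 1)" by (simp only: of_nat_less_iff)
  qed (use MX KM in auto)
  have split: "{1..M} = {1..K} \<union> {K<..M}" "{1..X} = {1..M} \<union> {M<..X}" using KM MX by auto
  have H: "(\<Sum>j\<in>{K<..M}. 1 / real j) = harm M - harm K"
    unfolding harm_def split(1) by (subst sum.union_disjoint) (auto simp: inverse_eq_divide)
  have JK: "(\<Sum>j\<in>{K<..M}. ln j / real j) = J_num M - J_num K"
    unfolding J_num_def split(1) by (subst sum.union_disjoint) auto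
  have JX: "(\<Sum>b\<in>{M<..X}. ln b / real b) = J_num X - J_num M"
    unfolding J_num_def split(2) by (subst sum.union_disjoint) auto

  \<comment> \<open>Deviations are measured from main terms at the real points \<open>x\<close>,
    \<open>s\<close> and \<open>N / j\<close>, not at their floors, so that the main terms combine
    algebraically.\<close>
  define e1 where "e1 = J_num X - (ln x)\<^sup>2 / 2 - stieltjes1"
  define e3 where "e3 = L X - (x * ln x - x)"
  define e4 where "e4 = L M - (s * ln s - s)"
  define e5 where "e5 = harm M - ln s - euler_mascheroni"
  define e6 where "e6 = (\<lambda>j. L (n div j) - (N / real j * ln (N / real j) - N / real j))"
  define E6 where "E6 = (\<Sum>j\<in>{K<..M}. e6 j)"
  \<comment> \<open>The constant is \<open>8 + 2\<close>: \<open>4 \<le> 8 * l\<close> and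
    \<open>ln x \<le> l\<close>. Then \<open>x \<ge> s\<close> and \<open>N / s = s\<close>.\<close>
  have e1: "\<bar>N * e1\<bar> \<le> 10 * (s * l)"
  proof -
    have "\<bar>e1\<bar> \<le> (4 + 2 * ln x) / x"
      using J_num_asymp[of x] s x unfolding e1_def nats by simp
    also have "\<dots> \<le> (10 * l) / s"
      using lnx_le l s x by (intro frac_le) auto
    finally have "N * \<bar>e1\<bar> \<le> N * ((10 * l) / s)"
      using N by (intro mult_left_mono) auto
    then show ?thesis using N s by (simp add: abs_mult)
  qed
  have e3: "\<bar>real K * e3\<bar> \<le> 3 * (s * l)"
  proof -
    have "\<bar>e3\<bar> \<le> 3 * l"
      using ln_sum_asymp[of x] s x lnx_le l unfolding e3_def L_def nats by simp
    then have "\<bar>real K\<bar> * \<bar>e3\<bar> \<le> s * (3 * l)"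
      using K inv\<alpha> s by (intro mult_mono) auto
    then show ?thesis by (simp add: abs_mult)
  qed
  have e4: "\<bar>real M * e4\<bar> \<le> 3 * (s * l)"
  proof -
    have "\<bar>e4\<bar> \<le> 3 * l"
      using ln_sum_asymp[OF s] lns l unfolding e4_def L_def nats by linarith
    then have "\<bar>real M\<bar> * \<bar>e4\<bar> \<le> s * (3 * l)"
      using M s by (intro mult_mono) auto
    then show ?thesis by (simp add: abs_mult)
  qed
  \<comment> \<open>Here \<open>l - 1\<close> may be negative; its absolute value is at most
    \<open>3 * l\<close>.\<close>
  have e5: "\<bar>N * ((l - 1) * e5)\<bar> \<le> 6 * (s * l)"
  proof -
    have "\<bar>e5\<bar> \<le> 2 / s"
      using harm_asymp[of s] s unfolding e5_def nats by simp
    then have "\<bar>l - 1\<bar> * \<bar>e5\<bar> \<le> (3 * l) * (2 / s)"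
      using l by (intro mult_mono) auto
    then have "N * (\<bar>l - 1\<bar> * \<bar>e5\<bar>) \<le> N * ((3 * l) * (2 / s))"
      using N by (intro mult_left_mono) auto
    then show ?thesis using N s by (simp add: abs_mult)
  qed
  have e6: "\<bar>E6\<bar> \<le> 3 * (s * l)"
  proof -
    have "\<bar>e6 j\<bar> \<le> 3 * l" if j: "j \<in> {K<..M}" for j
    proof -
      have "j \<ge> 1" "real j \<le> s" using j M by auto
      moreover from this have "real j * 1 \<le> s * s" using s by (intro mult_mono) auto
      ultimately have t: "1 \<le> N / j" "N / j \<le> N"
        using N by (auto simp: divide_simps)
      have "nat \<lfloor>N / j\<rfloor> = n div j"
        by (simp add: defs floor_divide_of_nat_eq)
      then have "\<bar>e6 j\<bar> \<le> 1 + ln (N / j)"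
        using ln_sum_asymp[OF t(1)] unfolding e6_def L_def by simp
      also have "ln (N / j) \<le> l" using t N by (simp add: defs)
      finally show ?thesis using l by linarith
    qed
    then have "\<bar>E6\<bar> \<le> (\<Sum>j\<in>{K<..M}. 3 * l)"
      unfolding E6_def by (intro order_trans[OF sum_abs] sum_mono) auto
    also have "\<dots> = real (M - K) * (3 * l)" by simp
    also have "\<dots> \<le> s * (3 * l)"
      using M l by (intro mult_right_mono) auto
    finally show ?thesis by simp
  qed
  \<comment> \<open>The cost of replacing the multiplier \<open>M\<close> of the main term of
    \<open>L M\<close> by \<open>s\<close>.\<close>
  have e7: "\<bar>(s - real M) * (s * ln s - s)\<bar> \<le> 3 * (s * l)"
  proof -
    have "s * ln s - s = s * (l / 2 - 1)" by (simp add: lns algebra_simps)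
    moreover have "\<bar>s * (l / 2 - 1)\<bar> \<le> s * (3 * l)"
      using s l by (simp add: abs_mult)
    ultimately have "\<bar>s - real M\<bar> * \<bar>s * ln s - s\<bar> \<le> 1 * (s * (3 * l))"
      using M by (intro mult_mono) auto
    then show ?thesis by (simp add: abs_mult)
  qed
  have LM: "(\<Sum>j\<in>{K<..M}. L (n div j))
      = E6 + N * ((l - 1) * (harm M - harm K) - (J_num M - J_num K))"
  proof -
    \<comment> \<open>Splitting \<open>ln (N / j)\<close> as \<open>l - ln j\<close> separates a
      harmonic part from a part for \<open>J_num\<close>.\<close>
    have "L (n div j) = e6 j + (N * (l - 1) * (1 / real j) - N * (ln j / real j))" if "j \<in> {K<..M}" for j
    proof -
      have "ln (N / j) = l - ln j" using that n by (simp add: defs ln_div)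
      then show ?thesis unfolding e6_def by (simp only:) (simp add: algebra_simps diff_divide_distrib)
    qed
    then have "(\<Sum>j\<in>{K<..M}. L (n div j))
       = (\<Sum>j\<in>{K<..M}. e6 j + (N * (l - 1) * (1 / real j) - N * (ln j / real j)))"
      by simp
    also have "\<dots> = E6 + (N * (l - 1) * (\<Sum>j\<in>{K<..M}. 1 / real j) - N * (\<Sum>j\<in>{K<..M}. ln j / real j))"
      unfolding E6_def sum.distrib sum_subtractf sum_distrib_left ..
    finally show ?thesis unfolding H JK by (simp add: algebra_simps)
  qed
  have "(\<Sum>b\<in>{M<..X}. (N / b - real (n div b)) * ln b)
      = N * (\<Sum>b\<in>{M<..X}. ln b / real b) - (\<Sum>b\<in>{M<..X}. real (n div b) * ln b)"
    by (simp add: sum_distrib_left sum_subtractf algebra_simps)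
  also have "\<dots> = N * (J_num X - J_num M) - (real K * L X
      + (E6 + N * ((l - 1) * (harm M - harm K) - (J_num M - J_num K))) - real M * L M)"
    unfolding JX T LM ..
  finally have S: "(\<Sum>b\<in>{M<..X}. (N / b - real (n div b)) * ln b) = \<dots>" .
  have fK: "real_of_int \<lfloor>1 / \<alpha>\<rfloor> = real K" using \<alpha>0 by (simp add: nats)
  have fB: "f_B \<alpha> = (1 - euler_mascheroni) + (harm K - lam) - \<alpha> * K"
    using \<alpha>0 by (simp add: f_B_def fK flip: nats defs)
  have gB: "g_B \<alpha> = (euler_mascheroni + stieltjes1 - 1) - (harm K - lam)
       - (J_num K - 1 / 2 * lam\<^sup>2) + lam * (- 1 + \<alpha> * K) + \<alpha> * K"
    using \<alpha>0 by (simp add: g_B_def fK flip: nats defs)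
  have J1: "J_num X = e1 + (l - lam)\<^sup>2 / 2 + stieltjes1" by (simp add: e1_def lnx)
  have L1: "L X = e3 + (\<alpha> * (s * s) * (l - lam) - \<alpha> * (s * s))"
  proof -
    have "x = \<alpha> * (s * s)" using N by (simp add: defs)
    then show ?thesis unfolding e3_def lnx by simp
  qed
  have L2: "L M = e4 + (s * (l / 2) - s)" by (simp add: e4_def lns)
  have H1: "harm M = e5 + l / 2 + euler_mascheroni" by (simp add: e5_def lns)
  \<comment> \<open>\<open>J_num M\<close> cancels, so no asymptotics for it is needed.\<close>
  have "(\<Sum>b\<in>{M<..X}. (N / b - real (n div b)) * ln b) - N * (f_B \<alpha> * l + g_B \<alpha>)
     = N * e1 - real K * e3 - E6 + real M * e4 - (s - real M) * (s * ln s - s) - N * ((l - 1) * e5)"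
    unfolding S fB gB J1 L1 L2 H1 lns unfolding N(2)
    by (simp add: field_simps power2_eq_square)
  \<comment> \<open>The six error bounds add up to
    \<open>10 + 3 + 3 + 3 + 3 + 6 = 28\<close>.\<close>
  then have "\<bar>(\<Sum>b\<in>{M<..X}. (N / b - real (n div b)) * ln b) - N * (f_B \<alpha> * l + g_B \<alpha>)\<bar>
     \<le> 28 * (s * l)"
    using e1 e3 e4 e5 e6 e7 by (simp only: abs_le_iff) linarith
  then show ?thesis unfolding nats defs .
qed

section \<open>Assembly for the two ranges of \<alpha>\<close>

theorem theorem3p3:
  shows "(\<exists>C::real. \<forall>n::nat. \<forall>\<alpha>::real. n \<ge> 2 \<longrightarrow> \<alpha> \<in> {1 / sqrt (real n)..1} \<longrightarrow>
            \<bar>B_bar n (\<alpha> * real n)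
               - (f_B \<alpha> * (real n)\<^sup>2 * ln (real n) + g_B \<alpha> * (real n)\<^sup>2)\<bar>
            \<le> C * (real n powr (3 / 2) * ln (real n)))
       \<and> (\<exists>C::real. \<forall>n::nat. \<forall>\<alpha>::real. n \<ge> 2 \<longrightarrow> \<alpha> \<in> {1 / real n..1 / sqrt (real n)} \<longrightarrow>
            \<bar>B_bar n (\<alpha> * real n)\<bar> \<le> C * (real n powr (3 / 2) * ln (real n)))"
proof -
  have powr: "real n powr (3 / 2) = n * sqrt n" if "n \<ge> 2" for n :: nat
    using that powr_add[of "real n" 1 "1 / 2"] by (simp add: powr_half_sqrt)
  \<comment> \<open>The constant is \<open>33 = 2 + 3 + 28\<close>: bases up to
    \<open>sqrt n\<close>, passage to fractional parts, and \<open>n\<close> times the error of the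
    fractional-part sum.\<close>
  have "\<bar>B_bar n (\<alpha> * real n) - (f_B \<alpha> * (real n)\<^sup>2 * ln (real n) + g_B \<alpha> * (real n)\<^sup>2)\<bar>
            \<le> 33 * (real n powr (3 / 2) * ln (real n))"
    if n: "n \<ge> 2" and \<alpha>: "\<alpha> \<in> {1 / sqrt (real n)..1}" for n :: nat and \<alpha> :: real
  proof -
    define s M X where defs: "s = sqrt n" "M = nat \<lfloor>s\<rfloor>" "X = nat \<lfloor>\<alpha> * n\<rfloor>"
    define t where "t = (\<lambda>b. (real n - 1) / (real b - 1) * real (digit_sum b n) * ln b)"
    define S where "S = (\<Sum>b\<in>{M<..X}. (real n / b - real (n div b)) * ln b)"
    define G where "G = f_B \<alpha> * ln n + g_B \<alpha>"
    have s: "s \<ge> 1" "s * s = n" using n by (auto simp: defs)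
    have M: "1 \<le> M" "s / 2 \<le> real M" "real M \<le> s" "s < real M + 1"
      using nat_floor_bounds[OF s(1)] s(1) unfolding defs(2) by auto
    have "s = 1 / s * n" using s by (simp flip: s(2))
    also have "\<dots> \<le> \<alpha> * n" using \<alpha> by (intro mult_right_mono) (auto simp: defs)
    finally have sx: "s \<le> \<alpha> * n" .
    then have MX: "M \<le> X" unfolding defs(2,3) by (intro nat_mono floor_mono)
    have "\<alpha> * n \<le> n" using \<alpha> n by (simp add: mult_left_le_one_le)
    then have Xn: "X \<le> n" unfolding defs(3) by linarith
    have "s * s < (real M + 1) * (real M + 1)" using M s by (intro mult_strict_mono) auto
    then have "real n < real ((M + 1) * (M + 1))" using s by (simp add: algebra_simps)
    then have nM: "n < (M + 1)\<^sup>2" by (simp only: of_nat_less_iff power2_eq_square)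
    have "{2..X} = {2..M} \<union> {M<..X}" using M MX by auto
    then have B: "B_bar n (\<alpha> * real n) = (\<Sum>b=2..M. t b) + (\<Sum>b\<in>{M<..X}. t b)"
      unfolding B_bar_def t_def[symmetric] defs(3)[symmetric]
      by (simp add: sum.union_disjoint ivl_disj_int)
    have b1: "\<bar>\<Sum>b=2..M. t b\<bar> \<le> 2 * (n * s * ln n)"
      using B_bar_initial_bound[OF n, of M] M unfolding t_def defs(1) by simp
    \<comment> \<open>\<open>M \<ge> s / 2\<close> turns the telescoped error
      \<open>n\<^sup>2 / M\<close> into the order \<open>n * sqrt n\<close>.\<close>
    have "(real n)\<^sup>2 / M \<le> (real n)\<^sup>2 / (s / 2)"
      using M s by (intro divide_left_mono) auto
    also have "\<dots> = 2 * (n * s)"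
      using s by (simp add: power2_eq_square flip: s(2))
    finally have "(real n)\<^sup>2 / M \<le> 2 * (n * s)" .
    moreover have "real n * 1 \<le> n * s" using s by (intro mult_left_mono) auto
    ultimately have "(real n)\<^sup>2 / M + n \<le> 3 * (n * s)" by linarith
    then have "((real n)\<^sup>2 / M + n) * ln n \<le> 3 * (n * s) * ln n"
      using n by (intro mult_right_mono) auto
    then have b2: "\<bar>(\<Sum>b\<in>{M<..X}. t b) - real n * S\<bar> \<le> 3 * (n * s * ln n)"
      using B_bar_tail[OF M(1) MX Xn nM] unfolding t_def S_def by simp
    have "\<bar>S - n * G\<bar> \<le> 28 * (s * ln n)"
      using fractional_part_sum_asymp[OF n, of \<alpha>] \<alpha> unfolding S_def G_def defs by simp
    then have "n * \<bar>S - n * G\<bar> \<le> n * (28 * (s * ln n))"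
      by (intro mult_left_mono) auto
    moreover have "n * \<bar>S - n * G\<bar> = \<bar>n * S - n * (n * G)\<bar>"
      by (simp add: abs_mult flip: right_diff_distrib)
    ultimately have b3: "\<bar>n * S - n * (n * G)\<bar> \<le> 28 * (n * s * ln n)"
      by (simp add: algebra_simps)
    have "f_B \<alpha> * (real n)\<^sup>2 * ln (real n) + g_B \<alpha> * (real n)\<^sup>2 = n * (n * G)"
      by (simp add: G_def power2_eq_square algebra_simps)
    then show ?thesis
      unfolding powr[OF n] B defs(1)[symmetric] using b1 b2 b3 by linarith
  qed
  \<comment> \<open>Now \<open>\<alpha> * n \<le> sqrt n\<close>, so the bound for the small bases
    covers the entire sum.\<close>
  moreover have "\<bar>B_bar n (\<alpha> * real n)\<bar> \<le> 2 * (real n powr (3 / 2) * ln (real n))"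
    if n: "n \<ge> 2" and \<alpha>: "\<alpha> \<in> {1 / real n..1 / sqrt (real n)}" for n :: nat and \<alpha> :: real
  proof -
    have "\<alpha> * n \<le> 1 / sqrt n * n" using \<alpha> by (intro mult_right_mono) auto
    also have "\<dots> = sqrt n" using n by (simp add: real_div_sqrt)
    finally have "real (nat \<lfloor>\<alpha> * n\<rfloor>) \<le> sqrt n"
      using real_sqrt_ge_zero[of "real n"] by linarith
    from B_bar_initial_bound[OF n this] show ?thesis
      unfolding B_bar_def powr[OF n] by simp
  qed
  ultimately show ?thesis by blast
qed

end
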